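(* Let $X$ be a geodesic metric space (with metric $d$) with a given basepoint $p$, and suppose a group $G$ acts on $X$ isometrically and co-boundedly. Set $l_p(g)=d(p,pg)$ and $c_p(g,h)=\frac12\left(l_p(g)+l_p(h)-l_p(gh^{-1})\right)$ for $g,h\in G$. Then there exist $0\le\epsilon<1$ and $K>0$ such that, for any $g\in G$, if $l_p(g)>K$ then there exists $x\in G$ with: (i) $0<l_p(x)\le K$, and (ii) $c_p(gx^{-1},x^{-1})\le\frac{\epsilon\, l_p(x)}{2}$.
   Context: Actions are right actions. $X$ is geodesic if for any two points of $X$ there is an isometric embedding of a closed real interval into $X$ taking the endpoints to the two given points. The action is co-bounded if there is a closed ball in $X$ whose $G$-translates cover $X$. *)

theory Defs
  imports "HOL-Analysis.Abstract_Metric_Spaces" "HOL-Algebra.Group"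
begin

context Metric_space
begin

definition geodesic_space :: bool where
  "geodesic_space \<longleftrightarrow>
     (\<forall>x\<in>M. \<forall>y\<in>M. \<exists>(a::real) b \<gamma>. a \<le> b \<and> \<gamma> \<in> {a..b} \<rightarrow> M \<and>
        (\<forall>s\<in>{a..b}. \<forall>t\<in>{a..b}. d (\<gamma> s) (\<gamma> t) = \<bar>s - t\<bar>) \<and> \<gamma> a = x \<and> \<gamma> b = y)"

end

text \<open>\<open>act x g\<close> is the point \<open>xg\<close>; the library's \<open>group_action\<close> is for left actions.\<close>

locale isometric_right_action = Metric_space M d + group G
  for M :: "'a set" and d and G (structure) and act :: "'a \<Rightarrow> 'g \<Rightarrow> 'a" +
  assumes act_closed: "\<lbrakk>x \<in> M; g \<in> carrier G\<rbrakk> \<Longrightarrow> act x g \<in> M"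
    and act_one: "x \<in> M \<Longrightarrow> act x \<one> = x"
    and act_mult: "\<lbrakk>x \<in> M; g \<in> carrier G; h \<in> carrier G\<rbrakk> \<Longrightarrow> act x (g \<otimes> h) = act (act x g) h"
    and act_isometric: "\<lbrakk>x \<in> M; y \<in> M; g \<in> carrier G\<rbrakk> \<Longrightarrow> d (act x g) (act y g) = d x y"
begin

definition cobounded :: bool where
  "cobounded \<longleftrightarrow> (\<exists>c\<in>M. \<exists>r. (\<Union>g\<in>carrier G. (\<lambda>x. act x g) ` mcball c r) = M)"

definition len :: "'a \<Rightarrow> 'g \<Rightarrow> real" where
  "len p g = d p (act p g)"

definition gromov_product :: "'a \<Rightarrow> 'g \<Rightarrow> 'g \<Rightarrow> real" where
  "gromov_product p g h = (len p g + len p h - len p (g \<otimes> inv h)) / 2"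

end

end

theory Submission
  imports Defs
begin

text \<open>
  Unravelling the definitions, and using that the action is isometric, the Gromov product
  \<open>c (g \<otimes> inv x) (inv x)\<close> is \<open>(d p (px) + d (px) (pg) - d p (pg)) / 2\<close>, half the detour made by
  travelling from \<open>p\<close> to \<open>pg\<close> through the orbit point \<open>px\<close>.  By co-boundedness the orbit of \<open>p\<close>
  is \<open>R\<close>-dense for some \<open>R > 0\<close>.  Walk a distance \<open>5 * R\<close> along a geodesic from \<open>p\<close> to \<open>pg\<close>
  and let \<open>px\<close> be an orbit point within \<open>R\<close> of where one stops.  The detour is then at most
  \<open>2 * R\<close>, whereas \<open>4 * R \<le> d p (px) \<le> 6 * R\<close>; so \<open>\<epsilon> = 1/2\<close> and \<open>K = 6 * R\<close> work.
\<close>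

lemma (in Metric_space) geodesic_space_point_at_distance:
  assumes "geodesic_space" "x \<in> M" "y \<in> M" "0 \<le> t" "t \<le> d x y"
  obtains z where "z \<in> M" "d x z = t" "d z y = d x y - t"
proof -
  obtain a b :: real and \<gamma> where \<gamma>: "a \<le> b" "\<gamma> \<in> {a..b} \<rightarrow> M" "\<gamma> a = x" "\<gamma> b = y"
    and iso: "\<forall>s\<in>{a..b}. \<forall>t\<in>{a..b}. d (\<gamma> s) (\<gamma> t) = \<bar>s - t\<bar>"
    using assms(1-3) unfolding geodesic_space_def by blast
  have len: "d x y = b - a"
    using iso[rule_format, of a b] \<gamma> by simp
  have mem: "a \<in> {a..b}" "b \<in> {a..b}" "a + t \<in> {a..b}"
    using assms(4,5) \<gamma>(1) len by auto
  have "d x (\<gamma> (a + t)) = t"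
    using iso[rule_format, OF mem(1,3)] \<gamma>(3) assms(4) by simp
  moreover have "d (\<gamma> (a + t)) y = d x y - t"
    using iso[rule_format, OF mem(3,2)] \<gamma>(4) assms(5) len by simp
  ultimately show thesis
    using that \<gamma>(2) mem(3) by blast
qed

context isometric_right_action
begin

lemma dist_orbit:
  assumes "p \<in> M" "g \<in> carrier G" "h \<in> carrier G"
  shows "d (act p g) (act p h) = len p (h \<otimes> inv g)"
proof -
  have "len p (h \<otimes> inv g) = d (act (act p g) (inv g)) (act (act p h) (inv g))"
    using assms by (simp add: len_def act_one flip: act_mult)
  then show ?thesis
    using assms by (simp add: act_isometric act_closed)
qed

lemma len_inv:
  assumes "p \<in> M" "g \<in> carrier G"
  shows "len p (inv g) = len p g"
  using dist_orbit[of p g \<one>] assms by (simp add: act_one len_def commute)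

lemma gromov_product_eq_detour:
  assumes "p \<in> M" "g \<in> carrier G" "x \<in> carrier G"
  shows "gromov_product p (g \<otimes> inv x) (inv x)
    = (d p (act p x) + d (act p x) (act p g) - d p (act p g)) / 2"
  using assms by (simp add: gromov_product_def dist_orbit len_inv m_assoc) (simp add: len_def)

text \<open>
  If the translates of a ball around \<open>c\<close> cover the space, then so do the translates of a larger
  ball around \<open>p\<close>, and translating the centre of that ball stays in the orbit of \<open>p\<close>.
\<close>

lemma cobounded_imp_orbit_dense:
  assumes "cobounded" "p \<in> M"
  obtains R where "R > 0" "\<And>y. y \<in> M \<Longrightarrow> \<exists>g\<in>carrier G. d (act p g) y \<le> R"
proof -
  obtain c r where c: "c \<in> M" and cover: "(\<Union>g\<in>carrier G. (\<lambda>x. act x g) ` mcball c r) = M"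
    using assms(1) unfolding cobounded_def by blast
  \<comment> \<open>The summand \<open>1\<close> keeps the radius positive when \<open>c = p\<close> and \<open>r = 0\<close>.\<close>
  let ?R = "d p c + \<bar>r\<bar> + 1"
  have "\<exists>g\<in>carrier G. d (act p g) y \<le> ?R" if "y \<in> M" for y
  proof -
    have "y \<in> (\<Union>g\<in>carrier G. (\<lambda>x. act x g) ` mcball c r)"
      unfolding cover by (fact that)
    then obtain g z where g: "g \<in> carrier G" and z: "z \<in> M" "d c z \<le> r" and y: "y = act z g"
      by auto
    have "d (act p g) y = d p z"
      using assms(2) g z y by (simp add: act_isometric)
    also have "\<dots> \<le> ?R"
      using triangle[OF assms(2) c z(1)] z(2) by linarith
    finally show ?thesis
      using g by blast
  qed
  moreover have "?R > 0"
    using nonneg[of p c] by linarith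
  ultimately show thesis
    using that by blast
qed

end

theorem corollary4p2:
  fixes M :: "'a set" and d :: "'a \<Rightarrow> 'a \<Rightarrow> real" and p :: 'a
    and G :: "('g, 'm) monoid_scheme" (structure) and act :: "'a \<Rightarrow> 'g \<Rightarrow> 'a"
  defines "l \<equiv> isometric_right_action.len d act p"
    and "c \<equiv> isometric_right_action.gromov_product d G act p"
  assumes "isometric_right_action M d G act"
    and "Metric_space.geodesic_space M d"
    and "isometric_right_action.cobounded M d G act"
    and "p \<in> M"
  shows "\<exists>\<epsilon> K :: real. 0 \<le> \<epsilon> \<and> \<epsilon> < 1 \<and> K > 0 \<and>
    (\<forall>g\<in>carrier G. l g > K \<longrightarrow>
      (\<exists>x\<in>carrier G. 0 < l x \<and> l x \<le> K \<and> c (g \<otimes> inv x) (inv x) \<le> \<epsilon> * l x / 2))"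
proof -
  interpret isometric_right_action M d G act by fact
  obtain R where R: "R > 0" and dense: "\<And>y. y \<in> M \<Longrightarrow> \<exists>g\<in>carrier G. d (act p g) y \<le> R"
    using cobounded_imp_orbit_dense assms(5,6) by blast
  have "\<exists>x\<in>carrier G. 0 < l x \<and> l x \<le> 6 * R \<and> c (g \<otimes> inv x) (inv x) \<le> (1/2) * l x / 2"
    if g: "g \<in> carrier G" and far: "l g > 6 * R" for g
  proof -
    let ?q = "act p g"
    have q: "?q \<in> M" and lg: "l g = d p ?q"
      using assms(6) g by (auto simp: act_closed l_def len_def)
    obtain z where z: "z \<in> M" "d p z = 5 * R" "d z ?q = d p ?q - 5 * R"
      by (rule geodesic_space_point_at_distance[OF assms(4,6) q, of "5 * R"])
        (use R far lg in auto)
    obtain x where x: "x \<in> carrier G" and near: "d (act p x) z \<le> R"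
      using dense[OF z(1)] by blast
    have px: "act p x \<in> M" and lx: "l x = d p (act p x)"
      using assms(6) x by (auto simp: act_closed l_def len_def)
    have lower: "4 * R \<le> l x"
      using triangle[OF assms(6) px z(1)] near z(2) lx by linarith
    have upper: "l x \<le> 6 * R"
      using triangle[OF assms(6) z(1) px] near z(2) lx by (simp add: commute)
    have "c (g \<otimes> inv x) (inv x) = (l x + d (act p x) ?q - d p ?q) / 2"
      using gromov_product_eq_detour[OF assms(6) g x] by (simp add: c_def lx)
    also have "\<dots> \<le> R"
      using triangle[OF px z(1) q] near upper z(3) by simp
    also have "\<dots> \<le> (1/2) * l x / 2"
      using lower by simp
    finally show ?thesis
      using x lower upper R by (intro bexI[of _ x]) auto
  qed
  then show ?thesis
    using R by (intro exI[of _ "1/2"] exI[of _ "6 * R"]) auto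
qed

end
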